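(* Let $k$ be a differential field of characteristic zero and let $E$ be an iterated antiderivative extension of $k$ with $C_E=C_k$. Suppose that $y\in E$, $y\notin k$, and that $y'=P(y)$ for some polynomial $P$ in one variable with coefficients in $k$. Then $\deg P\leq 2$.
   Context: A differential field is a field with a derivation $'$; $C_F=\{x\in F: x'=0\}$ is the field of constants of a differential field $F$. A differential field extension $E$ of $k$ is an iterated antiderivative extension of $k$ if $E=k(t_1,\dots,t_n)$ and there is a tower of differential fields $k=k_0\subset k_1\subset\cdots\subset k_n=E$ such that for each $i$, $k_i=k_{i-1}(t_i)$ and $t_i'\in k_{i-1}$. *)

theory Defs
  imports "HOL-Computational_Algebra.Polynomial" "HOL.Hull"
begin

text \<open>
  All fields of a tower are subfields of one ambient field, given by a type; the derivation
  \<open>D\<close> is only constrained on the differential fields in question.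
\<close>

(* Closure under 0 follows from 1 - 1, and inverse 0 = 0 is harmless. *)
definition is_subfield :: "'a::field set \<Rightarrow> bool" where
  "is_subfield K \<longleftrightarrow>
     1 \<in> K \<and> (\<forall>x\<in>K. \<forall>y\<in>K. x - y \<in> K \<and> x * y \<in> K) \<and> (\<forall>x\<in>K. inverse x \<in> K)"

definition differential_field :: "('a::field \<Rightarrow> 'a) \<Rightarrow> 'a set \<Rightarrow> bool" where
  "differential_field D K \<longleftrightarrow>
     is_subfield K \<and> (\<forall>x\<in>K. D x \<in> K) \<and>
     (\<forall>x\<in>K. \<forall>y\<in>K. D (x + y) = D x + D y \<and> D (x * y) = D x * y + x * D y)"

definition constants :: "('a::field \<Rightarrow> 'a) \<Rightarrow> 'a set \<Rightarrow> 'a set" where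
  "constants D K = {x \<in> K. D x = 0}"

definition adjoin :: "'a::field set \<Rightarrow> 'a set \<Rightarrow> 'a set" where
  "adjoin K S = is_subfield hull (K \<union> S)"

(* The inclusions K (i - 1) \<subseteq> K i follow from the adjoin equations and are not required to
   be strict; n = 0, i.e. E = k, is allowed. *)
definition iterated_antiderivative_extension ::
    "('a::field \<Rightarrow> 'a) \<Rightarrow> 'a set \<Rightarrow> 'a set \<Rightarrow> bool" where
  "iterated_antiderivative_extension D k E \<longleftrightarrow>
     (\<exists>(n::nat) (t :: nat \<Rightarrow> 'a) (K :: nat \<Rightarrow> 'a set).
        E = adjoin k (t ` {1..n}) \<and>
        K 0 = k \<and> K n = E \<and>
        (\<forall>i\<le>n. differential_field D (K i)) \<and>
        (\<forall>i\<in>{1..n}. K i = adjoin (K (i - 1)) {t i} \<and> D (t i) \<in> K (i - 1)))"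

end

theory Submission imports Defs begin

text \<open>
  Along the tower, let \<open>L = K(t)\<close> be the first field that contains \<open>y\<close>, so that
  \<open>y \<notin> K\<close> and \<open>D t \<in> K\<close>. As no new constants arise, \<open>t\<close> is transcendental over \<open>K\<close>
  (lemma \<open>antiderivative_transcendental\<close>), so \<open>L\<close> is a rational function field on which
  \<open>D\<close> acts through the derivation \<open>p \<mapsto> p\<^sup>D + D t \<cdot> dp/dx\<close> of \<open>K[x]\<close>, where \<open>p\<^sup>D\<close> has the
  derivatives of the coefficients of \<open>p\<close>; this derivation does not raise degrees.

  Suppose \<open>d = deg P \<ge> 3\<close> and write \<open>y = A(t) / B(t)\<close> in lowest terms. Clearing
  denominators in \<open>D y = P(y)\<close> gives
  \<open>B\<^bsup>d-2\<^esup> (A' B - A B') = (\<Sum>i\<le>d. c\<^sub>i A\<^sup>i B\<^bsup>d-i\<^esup>)\<close> in \<open>K[x]\<close>. Since \<open>d - 2 \<ge> 1\<close>, the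
  polynomial \<open>B\<close> divides \<open>c\<^sub>d A\<^sup>d\<close>, hence is a unit: a pole of order \<open>m\<close> of \<open>y\<close> would have
  order at most \<open>2 m\<close> in \<open>D y\<close> but order \<open>d m\<close> in \<open>P(y)\<close>. So \<open>y\<close> is a polynomial in
  \<open>t\<close>, and comparing degrees in \<open>A' = P \<circ> A\<close> gives \<open>d deg A \<le> deg A\<close>. Hence \<open>A\<close> is
  constant and \<open>y \<in> K\<close>, a contradiction.
\<close>

section \<open>Polynomials over a subfield\<close>

definition polys_over :: "'a::field set \<Rightarrow> 'a poly set" where
  "polys_over K = {p. \<forall>i. coeff p i \<in> K}"

lemma subfield_closed:
  assumes "is_subfield K"
  shows "1 \<in> K" "0 \<in> K" "x \<in> K \<Longrightarrow> y \<in> K \<Longrightarrow> x - y \<in> K"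
    "x \<in> K \<Longrightarrow> y \<in> K \<Longrightarrow> x * y \<in> K" "x \<in> K \<Longrightarrow> inverse x \<in> K"
    "x \<in> K \<Longrightarrow> - x \<in> K" "x \<in> K \<Longrightarrow> y \<in> K \<Longrightarrow> x + y \<in> K" "x \<in> K \<Longrightarrow> y \<in> K \<Longrightarrow> x / y \<in> K"
proof -
  have *: "1 \<in> K" "\<And>x y. x \<in> K \<Longrightarrow> y \<in> K \<Longrightarrow> x - y \<in> K"
    "\<And>x y. x \<in> K \<Longrightarrow> y \<in> K \<Longrightarrow> x * y \<in> K" "\<And>x. x \<in> K \<Longrightarrow> inverse x \<in> K"
    using assms by (auto simp: is_subfield_def)
  have zero: "0 \<in> K" using *(2)[OF *(1) *(1)] by simp
  have neg: "- x \<in> K" if "x \<in> K" for x using *(2)[OF zero that] by simp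
  show "1 \<in> K" "0 \<in> K" "x \<in> K \<Longrightarrow> y \<in> K \<Longrightarrow> x - y \<in> K"
    "x \<in> K \<Longrightarrow> y \<in> K \<Longrightarrow> x * y \<in> K" "x \<in> K \<Longrightarrow> inverse x \<in> K" "x \<in> K \<Longrightarrow> - x \<in> K"
    by (fact *(1) zero | erule (1) *(2) | erule (1) *(3) | erule *(4) | erule neg)+
  show "x \<in> K \<Longrightarrow> y \<in> K \<Longrightarrow> x + y \<in> K" using *(2)[of x "- y"] neg by simp
  show "x \<in> K \<Longrightarrow> y \<in> K \<Longrightarrow> x / y \<in> K" using *(3)[of x "inverse y"] *(4) by (simp add: field_simps)
qed

lemma subfield_sum:
  assumes "is_subfield K" and "\<And>i. i \<in> I \<Longrightarrow> f i \<in> K"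
  shows "sum f I \<in> K"
  using assms(2) by (induction I rule: infinite_finite_induct) (auto simp: subfield_closed[OF assms(1)])

lemma subfield_of_nat: "is_subfield K \<Longrightarrow> of_nat n \<in> K"
  by (induction n) (auto simp: subfield_closed)

lemma polys_over_closed:
  assumes K: "is_subfield K"
  shows "0 \<in> polys_over K" "1 \<in> polys_over K"
    "p \<in> polys_over K \<Longrightarrow> q \<in> polys_over K \<Longrightarrow> p + q \<in> polys_over K"
    "p \<in> polys_over K \<Longrightarrow> q \<in> polys_over K \<Longrightarrow> p - q \<in> polys_over K"
    "p \<in> polys_over K \<Longrightarrow> q \<in> polys_over K \<Longrightarrow> p * q \<in> polys_over K"
    "a \<in> K \<Longrightarrow> p \<in> polys_over K \<Longrightarrow> smult a p \<in> polys_over K"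
    "a \<in> K \<Longrightarrow> monom a n \<in> polys_over K"
    "pCons a p \<in> polys_over K \<longleftrightarrow> a \<in> K \<and> p \<in> polys_over K"
    "p \<in> polys_over K \<Longrightarrow> pderiv p \<in> polys_over K"
proof -
  show mult: "p * q \<in> polys_over K" if "p \<in> polys_over K" "q \<in> polys_over K" for p q
    using that by (auto simp: polys_over_def coeff_mult intro!: subfield_sum subfield_closed K)
  show "pCons a p \<in> polys_over K \<longleftrightarrow> a \<in> K \<and> p \<in> polys_over K"
    by (auto simp: polys_over_def coeff_pCons split: nat.splits)
  show "1 \<in> polys_over K"
    by (auto simp: polys_over_def coeff_1 subfield_closed K)
  show "p \<in> polys_over K \<Longrightarrow> pderiv p \<in> polys_over K"
    by (auto simp: polys_over_def coeff_pderiv simp del: of_nat_Suc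
        intro!: subfield_closed(4) subfield_of_nat K)
qed (auto simp: polys_over_def subfield_closed K)

lemma polys_over_power: "is_subfield K \<Longrightarrow> p \<in> polys_over K \<Longrightarrow> p ^ n \<in> polys_over K"
  by (induction n) (auto simp: polys_over_closed)

lemma polys_over_sum:
  assumes "is_subfield K" and "\<And>i. i \<in> I \<Longrightarrow> f i \<in> polys_over K"
  shows "sum f I \<in> polys_over K"
  using assms(2) by (induction I rule: infinite_finite_induct) (auto simp: polys_over_closed[OF assms(1)])

lemma polys_over_pcompose:
  assumes "is_subfield K" "p \<in> polys_over K" "q \<in> polys_over K"
  shows "p \<circ>\<^sub>p q \<in> polys_over K"
  using assms(2) by (induction p) (auto simp: pcompose_pCons polys_over_closed assms)

lemma polys_over_division:
  assumes K: "is_subfield K" and q: "q \<in> polys_over K" "q \<noteq> 0" and p: "p \<in> polys_over K"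
  shows "\<exists>s\<in>polys_over K. p - s * q = 0 \<or> degree (p - s * q) < degree q"
  using p
proof (induction "degree p" arbitrary: p rule: less_induct)
  case less
  show ?case
  proof (cases "p = 0 \<or> degree p < degree q")
    case True
    then show ?thesis by (intro bexI[of _ 0]) (auto simp: polys_over_closed K)
  next
    case False
    define m where "m = monom (lead_coeff p / lead_coeff q) (degree p - degree q)"
    have m: "m \<in> polys_over K"
      unfolding m_def using less.prems q
      by (intro polys_over_closed K subfield_closed) (auto simp: polys_over_def)
    have m0: "m \<noteq> 0" using False q by (auto simp: m_def)
    have degm: "degree (m * q) = degree p"
      using False q m0 by (auto simp: degree_mult_eq m_def degree_monom_eq)
    have "lead_coeff m = lead_coeff p / lead_coeff q" unfolding m_def by (rule lead_coeff_monom)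
    then have lc: "lead_coeff (m * q) = lead_coeff p"
      using q(2) by (simp only: lead_coeff_mult) simp
    have r: "p - m * q \<in> polys_over K"
      using less.prems q m by (auto simp: polys_over_closed K)
    show ?thesis
    proof (cases "p - m * q = 0")
      case True
      with m show ?thesis by blast
    next
      case False
      have "degree (p - m * q) < degree p"
      proof (rule ccontr)
        assume "\<not> ?thesis"
        moreover have "degree (p - m * q) \<le> degree p" using degm by (simp add: degree_diff_le)
        ultimately have "degree (p - m * q) = degree p" by simp
        then have "lead_coeff (p - m * q) = 0" using lc degm by (simp only: coeff_diff diff_self)
        with False show False by (simp only: leading_coeff_0_iff)
      qed
      from less.hyps[OF this r] obtain s where s: "s \<in> polys_over K"
        "p - m * q - s * q = 0 \<or> degree (p - m * q - s * q) < degree q" by blast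
      have "p - m * q - s * q = p - (m + s) * q" by (simp add: algebra_simps)
      with s m show ?thesis by (intro bexI[of _ "m + s"]) (auto simp: polys_over_closed K)
    qed
  qed
qed

text \<open>
  Among the nonzero combinations of \<open>p\<close> and \<open>q\<close> with cofactors over \<open>K\<close>, one of least
  degree divides both, by division with remainder. Working with combinations over \<open>K\<close>,
  rather than with a gcd in the ambient polynomial ring, keeps the quotients over \<open>K\<close>.
\<close>
lemma polys_over_common_divisor:
  assumes K: "is_subfield K" and p: "p \<in> polys_over K" and q: "q \<in> polys_over K" "q \<noteq> 0"
  obtains g u v p1 q1 where "g \<noteq> 0" "g = u * p + v * q" "p = p1 * g" "q = q1 * g"
    "p1 \<in> polys_over K" "q1 \<in> polys_over K"
proof -
  define comb where
    "comb g \<longleftrightarrow> g \<noteq> 0 \<and> (\<exists>u\<in>polys_over K. \<exists>v\<in>polys_over K. g = u * p + v * q)" for g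
  have "q = 0 * p + 1 * q" by simp
  then have "comb q" unfolding comb_def using q polys_over_closed(1,2)[OF K] by blast
  then obtain g where g: "comb g" and least: "\<And>h. comb h \<Longrightarrow> degree g \<le> degree h"
    using ex_has_least_nat[of comb q degree] by blast
  then obtain u v where uv: "u \<in> polys_over K" "v \<in> polys_over K" "g = u * p + v * q"
    and g0: "g \<noteq> 0" unfolding comb_def by blast
  have gK: "g \<in> polys_over K" using uv p q by (auto simp: polys_over_closed K)
  have dvd: "\<exists>s\<in>polys_over K. h = s * g"
    if h: "h = a * p + b * q" and ab: "a \<in> polys_over K" "b \<in> polys_over K" for h a b
  proof -
    have hK: "h \<in> polys_over K" using h ab p q by (auto simp: polys_over_closed K)
    obtain s where s: "s \<in> polys_over K" "h - s * g = 0 \<or> degree (h - s * g) < degree g"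
      using polys_over_division[OF K gK g0 hK] by blast
    have "h - s * g = (a - s * u) * p + (b - s * v) * q"
      unfolding h uv(3) by (simp add: algebra_simps)
    then have "comb (h - s * g)" if "h - s * g \<noteq> 0"
      unfolding comb_def using that ab s uv by (metis polys_over_closed(4,5) K)
    with least s have "h - s * g = 0" by (meson not_le)
    with s show ?thesis by auto
  qed
  obtain p1 where p1: "p1 \<in> polys_over K" "p = p1 * g"
    using dvd[of p 1 0] by (auto simp: polys_over_closed K)
  obtain q1 where q1: "q1 \<in> polys_over K" "q = q1 * g"
    using dvd[of q 0 1] by (auto simp: polys_over_closed K)
  from g0 uv p1 q1 that show ?thesis by blast
qed

section \<open>Simple extensions\<close>

text \<open>
  The hull is the least subfield containing \<open>K\<close> and \<open>t\<close>, and the fractions with denominator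
  not vanishing at \<open>t\<close> form such a subfield.
\<close>
lemma adjoin_fraction:
  assumes K: "is_subfield K" and y: "y \<in> adjoin K {t}"
  obtains p q where "p \<in> polys_over K" "q \<in> polys_over K" "poly q t \<noteq> 0" "y = poly p t / poly q t"
proof -
  define F where
    "F = {poly p t / poly q t | p q. p \<in> polys_over K \<and> q \<in> polys_over K \<and> poly q t \<noteq> 0}"
  have FI: "z \<in> F" if "p \<in> polys_over K" "q \<in> polys_over K" "poly q t \<noteq> 0"
    "z = poly p t / poly q t" for p q z
    using that by (auto simp: F_def)
  have sub: "K \<union> {t} \<subseteq> F"
  proof
    fix x assume "x \<in> K \<union> {t}"
    then show "x \<in> F"
      using FI[of "[:x:]" 1 x] FI[of "[:0, 1:]" 1 t]
      by (auto simp: polys_over_closed subfield_closed K)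
  qed
  have "is_subfield F"
    unfolding is_subfield_def
  proof (intro conjI ballI)
    show "1 \<in> F" using sub subfield_closed(1)[OF K] by auto
  next
    fix x assume "x \<in> F"
    then obtain p q where x: "p \<in> polys_over K" "q \<in> polys_over K" "poly q t \<noteq> 0"
      "x = poly p t / poly q t" by (auto simp: F_def)
    show "inverse x \<in> F"
    proof (cases "poly p t = 0")
      case True
      then show ?thesis using sub subfield_closed(2)[OF K] x by auto
    next
      case False
      with x show ?thesis by (intro FI[of q p]) auto
    qed
    fix z assume "z \<in> F"
    then obtain p' q' where z: "p' \<in> polys_over K" "q' \<in> polys_over K" "poly q' t \<noteq> 0"
      "z = poly p' t / poly q' t" by (auto simp: F_def)
    show "x - z \<in> F"
      using x z by (intro FI[of "p * q' - p' * q" "q * q'"])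
        (auto simp: polys_over_closed K diff_frac_eq)
    show "x * z \<in> F"
      using x z by (intro FI[of "p * p'" "q * q'"]) (auto simp: polys_over_closed K)
  qed
  with sub have "adjoin K {t} \<subseteq> F" unfolding adjoin_def by (intro hull_minimal)
  with y that show ?thesis by (auto simp: F_def)
qed

lemma adjoin_fraction_reduced:
  assumes K: "is_subfield K" and y: "y \<in> adjoin K {t}"
  obtains p q u v where "p \<in> polys_over K" "q \<in> polys_over K" "poly q t \<noteq> 0"
    "y = poly p t / poly q t" "u * p + v * q = 1"
proof -
  obtain p0 q0 where 0: "p0 \<in> polys_over K" "q0 \<in> polys_over K" "poly q0 t \<noteq> 0"
    "y = poly p0 t / poly q0 t"
    using adjoin_fraction[OF K y] .
  have q0: "q0 \<noteq> 0" using 0 by auto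
  obtain g u v p q where g: "g \<noteq> 0" "g = u * p0 + v * q0" "p0 = p * g" "q0 = q * g"
    "p \<in> polys_over K" "q \<in> polys_over K"
    using polys_over_common_divisor[OF K 0(1,2) q0] .
  have "(u * p + v * q) * g = u * p0 + v * q0"
    by (simp only: g(3,4) distrib_right mult.assoc)
  then have "(u * p + v * q) * g = 1 * g" by (simp only: g(2)[symmetric] mult_1)
  with \<open>g \<noteq> 0\<close> have "u * p + v * q = 1" using mult_right_cancel by blast
  moreover have "poly q t \<noteq> 0" "y = poly p t / poly q t" using 0(3,4) by (auto simp: g(3,4))
  ultimately show ?thesis using that[of p q u v] g(5,6) by simp
qed

lemma adjoin_superset: "K \<union> S \<subseteq> adjoin K S"
  unfolding adjoin_def by (rule hull_subset)

lemma adjoin_member: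
  assumes "is_subfield K" "t \<in> K"
  shows "adjoin K {t} = K"
  using assms adjoin_superset[of K "{t}"] hull_minimal[of "K \<union> {t}" K is_subfield]
  by (auto simp: adjoin_def)

section \<open>The induced derivation on polynomials\<close>

text \<open>For \<open>c = D t\<close>, this is the derivation of \<open>K[x]\<close> that extends \<open>D\<close> and sends \<open>x\<close> to \<open>c\<close>.\<close>
definition poly_derivation :: "('a::field_char_0 \<Rightarrow> 'a) \<Rightarrow> 'a \<Rightarrow> 'a poly \<Rightarrow> 'a poly" where
  "poly_derivation D c p = map_poly D p + smult c (pderiv p)"

lemma differential_field_simps:
  assumes "differential_field D K"
  shows "is_subfield K" "D 0 = 0" "D 1 = 0" "x \<in> K \<Longrightarrow> D x \<in> K"
    "x \<in> K \<Longrightarrow> y \<in> K \<Longrightarrow> D (x + y) = D x + D y"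
    "x \<in> K \<Longrightarrow> y \<in> K \<Longrightarrow> D (x * y) = D x * y + x * D y"
proof -
  have *: "is_subfield K" "\<And>x. x \<in> K \<Longrightarrow> D x \<in> K"
    "\<And>x y. x \<in> K \<Longrightarrow> y \<in> K \<Longrightarrow> D (x + y) = D x + D y"
    "\<And>x y. x \<in> K \<Longrightarrow> y \<in> K \<Longrightarrow> D (x * y) = D x * y + x * D y"
    using assms by (auto simp: differential_field_def)
  show "D 0 = 0" using *(3)[of 0 0] subfield_closed(2)[OF *(1)]
    by (metis add_0_left add_left_cancel add.right_neutral)
  show "D 1 = 0" using *(4)[of 1 1] subfield_closed(1)[OF *(1)]
    by (metis mult_1 mult_1_right add_left_cancel add.right_neutral)
qed (use assms in \<open>auto simp: differential_field_def\<close>)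

lemma coeff_poly_derivation:
  assumes "D 0 = 0"
  shows "coeff (poly_derivation D c p) i = D (coeff p i) + c * (of_nat (Suc i) * coeff p (Suc i))"
  using assms by (simp add: poly_derivation_def coeff_map_poly coeff_pderiv)

lemma poly_derivation_over:
  assumes "differential_field D K" "c \<in> K" "p \<in> polys_over K"
  shows "poly_derivation D c p \<in> polys_over K"
proof -
  have "map_poly D p \<in> polys_over K"
    using assms(3) differential_field_simps(2,4)[OF assms(1)]
    by (simp add: polys_over_def coeff_map_poly)
  then show ?thesis
    unfolding poly_derivation_def
    using assms differential_field_simps(1)[OF assms(1)] by (simp add: polys_over_closed)
qed

lemma degree_poly_derivation_le: "D 0 = 0 \<Longrightarrow> degree (poly_derivation D c p) \<le> degree p"
  by (rule degree_le) (auto simp: coeff_poly_derivation coeff_eq_0)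

lemma poly_in_subfield:
  assumes "is_subfield L" "p \<in> polys_over L" "t \<in> L"
  shows "poly p t \<in> L"
  using assms(2) by (induction p) (auto simp: polys_over_closed subfield_closed assms)

lemma derivation_poly:
  assumes L: "differential_field D L" and "t \<in> L" and "p \<in> polys_over L"
  shows "D (poly p t) = poly (poly_derivation D (D t) p) t"
  using assms(3)
proof (induction p)
  case 0
  then show ?case by (simp add: poly_derivation_def differential_field_simps[OF L])
next
  case (pCons a p)
  note L' = differential_field_simps[OF L]
  from pCons.prems have a: "a \<in> L" and p: "p \<in> polys_over L"
    by (auto simp: polys_over_closed L')
  have pt: "poly p t \<in> L" using poly_in_subfield L' p assms by blast
  have "D (poly (pCons a p) t) = D a + (D t * poly p t + t * D (poly p t))"
    using a pt assms by (simp add: L' subfield_closed)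
  also have "\<dots> = poly (poly_derivation D (D t) (pCons a p)) t"
    using pCons.IH[OF p] L'(2)
    by (simp add: poly_derivation_def pderiv_pCons map_poly_pCons algebra_simps)
  finally show ?case .
qed

text \<open>
  Applying \<open>D\<close> to an algebraic relation of least degree \<open>n\<close>, normalised to be monic, lowers
  its degree, so the derived relation is trivial. Its coefficient of index \<open>n - 1\<close> says that
  \<open>t + a\<^bsub>n-1\<^esub> / n\<close> is a constant.
\<close>
lemma antiderivative_transcendental:
  fixes D :: "'a::field_char_0 \<Rightarrow> 'a"
  assumes K: "differential_field D K" and L: "differential_field D L"
    and KL: "K \<subseteq> L" and t: "t \<in> L" "t \<notin> K" and Dt: "D t \<in> K"
    and C: "constants D L \<subseteq> K"
    and p: "p \<in> polys_over K" "poly p t = 0"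
  shows "p = 0"
proof (rule ccontr)
  assume "p \<noteq> 0"
  note K' = differential_field_simps[OF K] and L' = differential_field_simps[OF L]
  define rel where "rel q \<longleftrightarrow> q \<in> polys_over K \<and> poly q t = 0 \<and> q \<noteq> 0" for q
  have "rel p" using p \<open>p \<noteq> 0\<close> by (simp add: rel_def)
  then obtain q where q: "rel q" and least: "\<And>h. rel h \<Longrightarrow> degree q \<le> degree h"
    using ex_has_least_nat[of rel p degree] by blast
  define n where "n = degree q"
  define m where "m = smult (inverse (lead_coeff q)) q"
  have m: "m \<in> polys_over K" "poly m t = 0" "degree m = n" "coeff m n = 1"
    using q by (auto simp: m_def rel_def n_def polys_over_def subfield_closed K')
  have "n \<noteq> 0"
  proof
    assume "n = 0"
    with m(3,4) have "m = 1" by (metis degree_eq_zeroE coeff_pCons_0 one_pCons)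
    with m(2) show False by simp
  qed
  then obtain j where j: "n = Suc j" by (cases n) auto
  let ?m' = "poly_derivation D (D t) m"
  have mL: "m \<in> polys_over L" using m(1) KL by (auto simp: polys_over_def)
  have m'0: "?m' = 0"
  proof (rule ccontr)
    assume nz: "?m' \<noteq> 0"
    have "poly ?m' t = 0"
      using derivation_poly[OF L t(1) mL] m(2) L'(2) by simp
    with nz have "rel ?m'" unfolding rel_def using poly_derivation_over[OF K Dt m(1)] by blast
    from least[OF this] have "n \<le> degree ?m'" by (simp add: n_def)
    moreover have "degree ?m' \<le> n" using degree_poly_derivation_le[of D "D t" m] K'(2) m(3) by simp
    moreover have "coeff ?m' n = 0"
      using m(3,4) K' by (simp add: coeff_poly_derivation coeff_eq_0)
    ultimately have "lead_coeff ?m' = 0" by (metis le_antisym)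
    with nz show False by simp
  qed
  define a where "a = coeff m j / of_nat n"
  have a: "a \<in> K" unfolding a_def using m(1)
    by (auto intro!: subfield_closed(8) subfield_of_nat K' simp: polys_over_def)
  have na: "of_nat n * a = coeff m j" using \<open>n \<noteq> 0\<close> by (simp add: a_def)
  have n_const: "D (of_nat i) = 0" for i
    by (induction i) (auto simp: K' subfield_closed subfield_of_nat)
  have "D (coeff m j) = of_nat n * D a"
    using K'(6)[OF subfield_of_nat[OF K'(1), of n] a] n_const by (simp add: na)
  moreover have "D (coeff m j) + D t * of_nat n = 0"
    using arg_cong[OF m'0, of "\<lambda>r. coeff r j"] m(4) j K'(2)
    by (simp add: coeff_poly_derivation del: of_nat_Suc)
  ultimately have "of_nat n * (D t + D a) = 0" by (simp add: algebra_simps)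
  then have "D (t + a) = 0" using \<open>n \<noteq> 0\<close> L'(5)[of t a] t a KL by auto
  then have "t + a \<in> constants D L"
    using t a KL by (auto simp: constants_def subfield_closed L')
  with C have "t + a - a \<in> K" using a subfield_closed(3)[OF K'(1)] by blast
  with t show False by simp
qed

section \<open>The equation in one step of the tower\<close>

text \<open>This is \<open>q\<^bsup>deg P\<^esup> P(p / q)\<close>, written without division.\<close>
definition homogenize :: "'a::field poly \<Rightarrow> 'a poly \<Rightarrow> 'a poly \<Rightarrow> 'a poly" where
  "homogenize P p q = (\<Sum>i\<le>degree P. smult (coeff P i) (p ^ i * q ^ (degree P - i)))"

lemma poly_homogenize:
  assumes "poly q t \<noteq> 0"
  shows "poly (homogenize P p q) t = poly q t ^ degree P * poly P (poly p t / poly q t)"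
  unfolding homogenize_def poly_sum poly_altdef[of P] sum_distrib_left
  by (rule sum.cong) (use assms in \<open>auto simp: power_divide power_diff field_simps\<close>)

lemma homogenize_over:
  assumes "is_subfield K" "P \<in> polys_over K" "p \<in> polys_over K" "q \<in> polys_over K"
  shows "homogenize P p q \<in> polys_over K"
  unfolding homogenize_def using assms
  by (intro polys_over_sum polys_over_closed polys_over_power) (auto simp: polys_over_def)

text \<open>Every summand except the one for the leading term of \<open>P\<close> contains a factor \<open>q\<close>.\<close>
lemma dvd_homogenize_imp_dvd_power:
  assumes "q dvd homogenize P p q" "P \<noteq> 0"
  shows "q dvd p ^ degree P"
proof -
  have "homogenize P p q = (\<Sum>i<degree P. smult (coeff P i) (p ^ i * q ^ (degree P - i)))
      + smult (lead_coeff P) (p ^ degree P)"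
    by (simp add: homogenize_def lessThan_Suc_atMost[symmetric])
  moreover have "q dvd (\<Sum>i<degree P. smult (coeff P i) (p ^ i * q ^ (degree P - i)))"
    by (intro dvd_sum dvd_smult dvd_mult dvd_power) auto
  ultimately have "q dvd smult (lead_coeff P) (p ^ degree P)"
    using assms(1) by (simp add: dvd_add_right_iff)
  with assms(2) show ?thesis by (simp add: dvd_smult_iff)
qed

text \<open>
  Coprimality is used in the form of a Bezout identity: multiplying it by \<open>p\<^sup>n\<close> shows that
  \<open>q dvd p\<^bsup>n+1\<^esup>\<close> implies \<open>q dvd p\<^sup>n\<close>, down to \<open>q dvd 1\<close>.
\<close>
lemma dvd_power_coprime_degree_0:
  fixes p q u v :: "'a::field poly"
  assumes "u * p + v * q = 1" "q dvd p ^ n"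
  shows "degree q = 0"
proof -
  have "q dvd 1"
    using assms(2)
  proof (induction n)
    case (Suc n)
    then have "q dvd u * p * p ^ n" by (metis dvd_mult mult.assoc power_Suc)
    moreover have "(u * p + v * q) * p ^ n = u * p * p ^ n + q * (v * p ^ n)"
      by (simp add: algebra_simps)
    then have "p ^ n = u * p * p ^ n + q * (v * p ^ n)" by (simp only: assms(1) mult_1)
    ultimately have "q dvd p ^ n" by (metis dvd_add dvd_triv_left)
    then show ?case by (rule Suc.IH)
  qed simp
  then show ?thesis by (simp add: is_unit_poly_iff) auto
qed

text \<open>
  The bound \<open>deg P > 2\<close> enters twice: it leaves a factor \<open>B\<close> after the denominator
  \<open>B\<^sup>2\<close> of the quotient rule is cleared, which excludes poles, and it makes the degree of
  \<open>P \<circ> Q\<close> exceed that of the derivative of \<open>Q\<close>, which excludes nonconstant polynomials.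
\<close>
lemma antiderivative_step:
  fixes D :: "'a::field_char_0 \<Rightarrow> 'a"
  assumes K: "differential_field D K" and L: "differential_field D L"
    and LK: "L = adjoin K {t}" and Dt: "D t \<in> K"
    and C: "constants D L \<subseteq> K"
    and y: "y \<in> L" and P: "P \<in> polys_over K" and Dy: "D y = poly P y"
    and deg: "degree P > 2"
  shows "y \<in> K"
proof (cases "t \<in> K")
  case True
  then show ?thesis using adjoin_member K y LK by (metis differential_field_simps(1))
next
  case False
  note K' = differential_field_simps[OF K] and L' = differential_field_simps[OF L]
  have KL: "K \<subseteq> L" and t: "t \<in> L" using adjoin_superset[of K "{t}"] LK by auto
  have eqI: "p = q" if "p \<in> polys_over K" "q \<in> polys_over K" "poly p t = poly q t" for p q
    using antiderivative_transcendental[OF K L KL t False Dt C, of "p - q"] that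
    by (auto simp: polys_over_closed K')
  have Dpoly: "D (poly p t) = poly (poly_derivation D (D t) p) t" if "p \<in> polys_over K" for p
    using derivation_poly[OF L t] that KL by (auto simp: polys_over_def)
  obtain A B u v where AB: "A \<in> polys_over K" "B \<in> polys_over K" "poly B t \<noteq> 0"
    "y = poly A t / poly B t" "u * A + v * B = 1"
    using adjoin_fraction_reduced[OF K'(1)] y LK by metis
  let ?A' = "poly_derivation D (D t) A" and ?B' = "poly_derivation D (D t) B"
  let ?a = "poly A t" and ?b = "poly B t"
  have A'B': "?A' \<in> polys_over K" "?B' \<in> polys_over K"
    using poly_derivation_over[OF K Dt] AB by auto
  have bL: "?b \<in> L" using poly_in_subfield[OF L'(1) _ t] AB KL by (auto simp: polys_over_def)
  have "?a = y * ?b" using AB by simp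
  then have "poly ?A' t = D y * ?b + y * poly ?B' t"
    using L'(6)[OF y bL] Dpoly AB by metis
  then have quotient_rule: "poly ?A' t * ?b - ?a * poly ?B' t = D y * ?b ^ 2"
    using \<open>?a = y * ?b\<close> by (simp add: algebra_simps power2_eq_square)
  have "B ^ (degree P - 2) * (?A' * B - A * ?B') = homogenize P A B"
  proof (rule eqI)
    show "B ^ (degree P - 2) * (?A' * B - A * ?B') \<in> polys_over K"
      using AB A'B' by (intro polys_over_closed polys_over_power K')
    show "homogenize P A B \<in> polys_over K" using homogenize_over K' P AB by blast
    have "degree P - 2 + 2 = degree P" using deg by simp
    then have "?b ^ (degree P - 2) * ?b ^ 2 = ?b ^ degree P" by (metis power_add)
    then show "poly (B ^ (degree P - 2) * (?A' * B - A * ?B')) t = poly (homogenize P A B) t"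
      using AB(3,4) Dy quotient_rule by (simp add: poly_homogenize power_mult_distrib)
  qed
  moreover have "B dvd B ^ (degree P - 2)" using deg by (intro dvd_power) auto
  ultimately have "B dvd homogenize P A B" by (metis dvd_mult2)
  moreover have "P \<noteq> 0" using deg by auto
  ultimately have "degree B = 0"
    using dvd_homogenize_imp_dvd_power dvd_power_coprime_degree_0 AB(5) by metis
  then obtain b where b: "B = [:b:]" by (rule degree_eq_zeroE)
  define Q where "Q = smult (inverse b) A"
  have bK: "b \<in> K" using AB(2) b by (simp add: polys_over_closed K')
  have Q: "Q \<in> polys_over K" unfolding Q_def using bK AB(1)
    by (intro polys_over_closed subfield_closed K')
  have yQ: "y = poly Q t" using AB(4) b by (simp add: Q_def field_simps)
  have "poly_derivation D (D t) Q = P \<circ>\<^sub>p Q"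
    using Dy Dpoly[OF Q] poly_derivation_over[OF K Dt Q] polys_over_pcompose[OF K'(1) P Q]
    by (intro eqI) (auto simp: yQ poly_pcompose)
  then have "degree P * degree Q \<le> degree Q"
    using degree_poly_derivation_le[of D "D t" Q] K'(2) by (simp add: degree_pcompose)
  moreover have "2 * degree Q \<le> degree P * degree Q" using deg by (intro mult_le_mono1) simp
  ultimately have "degree Q = 0" by linarith
  then obtain e where "Q = [:e:]" by (rule degree_eq_zeroE)
  with Q yQ show ?thesis by (simp add: polys_over_closed K')
qed

section \<open>Towers\<close>

theorem mainTheorem2:
  fixes D :: "'a::field_char_0 \<Rightarrow> 'a" and k E :: "'a set" and y :: 'a and P :: "'a poly"
  assumes "differential_field D k"
    and "differential_field D E"
    and "iterated_antiderivative_extension D k E"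
    and "constants D E = constants D k"
    and "y \<in> E" and "y \<notin> k"
    and "\<forall>i. coeff P i \<in> k"
    and "D y = poly P y"
  shows "degree P \<le> 2"
proof (rule ccontr)
  assume "\<not> degree P \<le> 2"
  then have deg: "degree P > 2" by simp
  obtain K t and n :: nat
    where tower: "K 0 = k" "K n = E" "\<forall>i\<le>n. differential_field D (K i)"
    and step: "\<forall>i\<in>{1..n}. K i = adjoin (K (i - 1)) {t i} \<and> D (t i) \<in> K (i - 1)"
    using assms(3) unfolding iterated_antiderivative_extension_def by blast
  have Suc_sub: "K i \<subseteq> K (Suc i)" if "Suc i \<le> n" for i
    using step[rule_format, of "Suc i"] that adjoin_superset[of "K i" "{t (Suc i)}"] by auto
  have mono: "K i \<subseteq> K j" if "i \<le> j" "j \<le> n" for i j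
    using that
  proof (induction j rule: dec_induct)
    case (step m)
    then show ?case using Suc_sub[of m] by simp
  qed simp
  \<comment> \<open>minimality of \<open>i\<close> puts \<open>y\<close> in exactly one of the two fields of a step\<close>
  define i where "i = (LEAST i. y \<in> K i)"
  have yi: "y \<in> K i" unfolding i_def using assms(5) tower(2) by (metis LeastI)
  have i: "i \<le> n" unfolding i_def using assms(5) tower(2) by (metis Least_le)
  have "i \<noteq> 0" using yi tower(1) assms(6) by metis
  then obtain j where j: "i = Suc j" by (cases i) auto
  have "y \<notin> K j" using not_less_Least[of j "\<lambda>i. y \<in> K i"] j by (simp add: i_def)
  moreover have "y \<in> K j"
  proof (rule antiderivative_step)
    show "differential_field D (K j)" "differential_field D (K i)" using tower i j by auto
    show "K i = adjoin (K j) {t i}" "D (t i) \<in> K j" using step[rule_format, of i] i j by auto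
    have "constants D (K i) \<subseteq> constants D E"
      using mono[OF i] tower(2) by (auto simp: constants_def)
    then show "constants D (K i) \<subseteq> K j"
      using assms(4) mono[of 0 j] tower(1) i j by (auto simp: constants_def)
    show "P \<in> polys_over (K j)"
      using assms(7) mono[of 0 j] tower(1) i j by (auto simp: polys_over_def)
  qed (fact yi assms(8) deg)+
  ultimately show False by simp
qed

end
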